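(* Let $N\ge 2$ be an integer, let $A, T_s, v^{\rm m}, \lambda, \sigma^2, P, |\beta|$ be positive reals, and put $\Delta := v^{\rm m}T_s$. Suppose $A<(N-1)\Delta$ (the space-constrained regime). Call a pair $(\bm{x},\bm{v})$ with $\bm{x}=[x_1,\dots,x_N]^{\mathsf T}\in\mathbb{R}^N$, $\bm{v}=[v_1,\dots,v_{N-1}]^{\mathsf T}\in\mathbb{R}^{N-1}$ feasible if $-v^{\rm m}\le v_n\le v^{\rm m}$ for $n=1,\dots,N-1$, $0\le x_n\le A$ for $n=1,\dots,N$, and $x_n = x_1+T_s\sum_{m=1}^{n-1}v_m$ for $n=2,\dots,N$. Let $$N_{\rm M}=\left\lceil\frac{A}{\Delta}\right\rceil-1,\qquad N_{\rm L}=\left\lceil\frac{N-N_{\rm M}}{2}\right\rceil,\qquad N_{\rm R}=\left\lfloor\frac{N-N_{\rm M}}{2}\right\rfloor .$$ Then an optimal velocity vector, i.e. one that (together with the positions below) minimizes ${\rm CRB}_u(\bm{x})$ over all feasible pairs, is $$v_n^{\rm SC}=\begin{cases}0,& n=1,\dots,N_{\rm L}-1,\\ v^{\rm m},& n=N_{\rm L},\dots,N-N_{\rm R}-1,\\ \dfrac{A-N_{\rm M}\Delta}{T_s},& n=N-N_{\rm R},\\ 0,& n=N-N_{\rm R}+1,\dots,N-1,\end{cases}$$ with corresponding position vector $$x_n^{\rm SC}=\begin{cases}0,& n=1,\dots,N_{\rm L},\\ (n-N_{\rm L})\Delta,& n=N_{\rm L}+1,\dots,N-N_{\rm R},\\ A,&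 n=N-N_{\rm R}+1,\dots,N\end{cases}$$ (index ranges whose lower end exceeds their upper end are empty). The resulting minimum value is $${\rm CRB}_u(\bm{x}^{\rm SC})=\frac{\sigma^2\lambda^2}{8\pi^2P|\beta|^2}\,\frac{1}{N\,{\rm var}(\bm{x}^{\rm SC})},$$ where $${\rm var}(\bm{x}^{\rm SC})=\frac{\Delta^2}{6N}N_{\rm M}(N_{\rm M}+1)(2N_{\rm M}+1)+\frac{A^2}{N}\left\lfloor\frac{N-N_{\rm M}}{2}\right\rfloor-\frac{1}{N^2}\left(\frac{\Delta}{2}N_{\rm M}(N_{\rm M}+1)+\left\lfloor\frac{N-N_{\rm M}}{2}\right\rfloor A\right)^2 .$$ This minimum CRB decreases with $N$ in the order of $\mathcal{O}(N^{-1})$ (as $N\to\infty$, all other parameters fixed) and decreases with $A$ in the order of $\mathcal{O}(A^{-2})$ (for $A$ ranging over $(0,(N-1)\Delta)$, all other parameters fixed, i.e. it is at most a constant independent of $A$ times $A^{-2}$).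
   Context: A single movable antenna moves along the line segment $[0,A]$; $x_n$ is its position at the $n$th of $N$ snapshots, $v_n$ its velocity between snapshots $n$ and $n+1$, $T_s$ the time between snapshots, and $v^{\rm m}$ the maximum speed. The constants $\lambda$ (wavelength), $\sigma^2$ (noise power), $P$ (signal power), $|\beta|$ (channel gain magnitude) are positive. For $\bm{x}\in\mathbb{R}^N$ define $\mu(\bm{x})=\frac1N\sum_{n=1}^N x_n$ and ${\rm var}(\bm{x})=\frac1N\sum_{n=1}^N x_n^2-\mu(\bm{x})^2$. The Cramér–Rao bound for estimating the spatial angle of arrival $u$ is the function $${\rm CRB}_u(\bm{x})=\frac{\sigma^2\lambda^2}{8\pi^2PN|\beta|^2}\,\frac{1}{{\rm var}(\bm{x})},$$ with the convention ${\rm CRB}_u(\bm{x})=+\infty$ when ${\rm var}(\bm{x})=0$; minimizing ${\rm CRB}_u$ is equivalent to maximizing ${\rm var}(\bm{x})$. $\lceil\cdot\rceil$ and $\lfloor\cdot\rfloor$ are the ceiling and floor functions. *)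

theory Defs
  imports Complex_Main "HOL-Library.Extended_Real" "HOL-Library.Landau_Symbols"
begin

text \<open>
  The number of snapshots varies (the limit in \<open>N\<close> is taken), so a vector in \<open>\<real>\<^sup>N\<close> is a function
  \<open>nat \<Rightarrow> real\<close> of which only the entries \<open>1, \<dots>, N\<close> are used.
\<close>

definition mu :: "nat \<Rightarrow> (nat \<Rightarrow> real) \<Rightarrow> real" where
  "mu N x = 1 / real N * (\<Sum>n = 1..N. x n)"

definition var :: "nat \<Rightarrow> (nat \<Rightarrow> real) \<Rightarrow> real" where
  "var N x = 1 / real N * (\<Sum>n = 1..N. (x n)\<^sup>2) - (mu N x)\<^sup>2"

definition CRB :: "real \<Rightarrow> real \<Rightarrow> real \<Rightarrow> complex \<Rightarrow> nat \<Rightarrow> (nat \<Rightarrow> real) \<Rightarrow> ereal" where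
  "CRB \<sigma> lam P \<beta> N x =
     (if var N x = 0 then \<infinity>
      else ereal (\<sigma>\<^sup>2 * lam\<^sup>2 / (8 * pi\<^sup>2 * P * real N * (cmod \<beta>)\<^sup>2) * (1 / var N x)))"

definition feasible ::
    "real \<Rightarrow> real \<Rightarrow> real \<Rightarrow> nat \<Rightarrow> (nat \<Rightarrow> real) \<times> (nat \<Rightarrow> real) \<Rightarrow> bool" where
  "feasible A vm Ts N = (\<lambda>(x, v).
     (\<forall>n\<in>{1..N - 1}. - vm \<le> v n \<and> v n \<le> vm) \<and>
     (\<forall>n\<in>{1..N}. 0 \<le> x n \<and> x n \<le> A) \<and>
     (\<forall>n\<in>{2..N}. x n = x 1 + Ts * (\<Sum>m = 1..n - 1. v m)))"

definition min_CRB ::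
    "real \<Rightarrow> real \<Rightarrow> real \<Rightarrow> complex \<Rightarrow> real \<Rightarrow> real \<Rightarrow> nat \<Rightarrow> real \<Rightarrow> ereal" where
  "min_CRB \<sigma> lam P \<beta> vm Ts N A =
     (INF (x, v) \<in> {p. feasible A vm Ts N p}. CRB \<sigma> lam P \<beta> N x)"

definition N_M :: "real \<Rightarrow> real \<Rightarrow> int" where
  "N_M \<Delta> A = \<lceil>A / \<Delta>\<rceil> - 1"

definition N_L :: "real \<Rightarrow> nat \<Rightarrow> real \<Rightarrow> int" where
  "N_L \<Delta> N A = \<lceil>(real N - real_of_int (N_M \<Delta> A)) / 2\<rceil>"

definition N_R :: "real \<Rightarrow> nat \<Rightarrow> real \<Rightarrow> int" where
  "N_R \<Delta> N A = \<lfloor>(real N - real_of_int (N_M \<Delta> A)) / 2\<rfloor>"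

definition v_SC :: "real \<Rightarrow> real \<Rightarrow> nat \<Rightarrow> real \<Rightarrow> nat \<Rightarrow> real" where
  "v_SC vm Ts N A n = (let \<Delta> = vm * Ts in
     if int n \<le> N_L \<Delta> N A - 1 then 0
     else if int n \<le> int N - N_R \<Delta> N A - 1 then vm
     else if int n = int N - N_R \<Delta> N A then (A - real_of_int (N_M \<Delta> A) * \<Delta>) / Ts
     else 0)"

definition x_SC :: "real \<Rightarrow> real \<Rightarrow> nat \<Rightarrow> real \<Rightarrow> nat \<Rightarrow> real" where
  "x_SC vm Ts N A n = (let \<Delta> = vm * Ts in
     if int n \<le> N_L \<Delta> N A then 0
     else if int n \<le> int N - N_R \<Delta> N A then real_of_int (int n - N_L \<Delta> N A) * \<Delta>
     else A)"

end

theory Submission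
  imports Defs "HOL-Library.Multiset"
begin

text \<open>
  Minimizing the bound means maximizing the variance of the positions. Sorting a feasible path
  keeps its steps below \<open>\<Delta>\<close>. A sorted path \<open>x\<close> is majorized by the clipped full-speed path
  \<open>n \<mapsto> max 0 (min A (\<tau> + n \<Delta>))\<close> with the same sum. Between two neighbouring values of \<open>\<tau>\<close> at which
  a sample hits \<open>0\<close> or \<open>A\<close> this path is affine in \<open>\<tau>\<close>, so by convexity the variance is largest at
  such a value, and by reflection \<open>\<tau>\<close> may be taken in \<open>\<int> \<Delta>\<close>. Passing from \<open>\<tau>\<close> to \<open>\<tau> + \<Delta>\<close> drops one
  end sample and adds another; pairing the remaining samples symmetrically shows that the variance
  increases as long as \<open>2 \<tau> + (N + 2) \<Delta> \<le> A\<close> and decreases afterwards, which singles out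
  \<open>\<tau> = - N_L \<Delta>\<close>.
\<close>

subsection \<open>Variance of a finite sequence\<close>

lemma var_scaled:
  assumes "N > 0"
  shows "(real N)\<^sup>2 * var N x = real N * (\<Sum>n = 1..N. (x n)\<^sup>2) - (\<Sum>n = 1..N. x n)\<^sup>2"
  using assms by (simp add: var_def mu_def power2_eq_square field_simps)

lemma var_cong:
  assumes "\<And>n. n \<in> {1..N} \<Longrightarrow> x n = y n"
  shows "var N x = var N y"
  using assms by (simp add: var_def mu_def)

text \<open>The pairwise form makes translation invariance, convexity and monotonicity in the
  distances visible; most comparisons of variances below go through it.\<close>

lemma var_pairs:
  assumes "N > 0"
  shows "(real N)\<^sup>2 * var N x = (\<Sum>i = 1..N. \<Sum>j = 1..N. (x i - x j)\<^sup>2) / 2"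
proof -
  have "(\<Sum>i = 1..N. \<Sum>j = 1..N. (x i - x j)\<^sup>2)
      = (\<Sum>i = 1..N. real N * (x i)\<^sup>2 + (\<Sum>j = 1..N. (x j)\<^sup>2) - 2 * x i * (\<Sum>j = 1..N. x j))"
    by (simp add: power2_diff sum.distrib sum_subtractf sum_distrib_left mult.assoc)
  also have "\<dots> = 2 * (real N * (\<Sum>n = 1..N. (x n)\<^sup>2) - (\<Sum>n = 1..N. x n)\<^sup>2)"
    by (simp add: sum.distrib sum_subtractf power2_eq_square flip: sum_distrib_left sum_distrib_right)
  finally show ?thesis
    using assms by (simp add: var_scaled)
qed

lemma var_nonneg:
  assumes "N > 0"
  shows "0 \<le> var N x"
proof -
  have "0 \<le> (real N)\<^sup>2 * var N x"
    unfolding var_pairs[OF assms] by (simp add: sum_nonneg)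
  with assms show ?thesis
    by (simp add: zero_le_mult_iff)
qed

text \<open>Among ordered pairs, \<open>(a, b)\<close> and \<open>(b, a)\<close> both contribute the
  square, which cancels the factor 1/2 of \<open>var_pairs\<close>.\<close>

lemma var_ge_sq_diff:
  assumes "a \<in> {1..N}" "b \<in> {1..N}" "a \<noteq> b"
  shows "(x a - x b)\<^sup>2 \<le> (real N)\<^sup>2 * var N x"
proof -
  have N: "N > 0" using assms by auto
  have row: "(x i - x j)\<^sup>2 \<le> (\<Sum>j = 1..N. (x i - x j)\<^sup>2)" if "j \<in> {1..N}" for i j
    using that by (intro member_le_sum) auto
  have "(\<Sum>i\<in>{a, b}. \<Sum>j = 1..N. (x i - x j)\<^sup>2) \<le> (\<Sum>i = 1..N. \<Sum>j = 1..N. (x i - x j)\<^sup>2)"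
    using assms by (intro sum_mono2) (auto simp: sum_nonneg)
  moreover have "(x a - x b)\<^sup>2 + (x b - x a)\<^sup>2 \<le> (\<Sum>i\<in>{a, b}. \<Sum>j = 1..N. (x i - x j)\<^sup>2)"
    using row[of b a] row[of a b] assms by simp
  ultimately show ?thesis
    unfolding var_pairs[OF N] by (simp add: power2_commute[of "x b"])
qed

text \<open>Spreading the points apart enlarges the squared distances pair by pair; the two extreme
  points give strictness.\<close>

lemma var_strict_mono_differences:
  assumes N: "2 \<le> N"
    and le: "\<And>i j. 1 \<le> i \<Longrightarrow> i \<le> j \<Longrightarrow> j \<le> N \<Longrightarrow> 0 \<le> x j - x i \<and> x j - x i \<le> y j - y i"
    and less: "x N - x 1 < y N - y 1"
  shows "var N x < var N y"
proof -
  have entry: "(x i - x j)\<^sup>2 \<le> (y i - y j)\<^sup>2" if "i \<in> {1..N}" "j \<in> {1..N}" for i j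
  proof (cases "i \<le> j")
    case True
    then have "(x j - x i)\<^sup>2 \<le> (y j - y i)\<^sup>2"
      using le[of i j] that by (intro power_mono) auto
    then show ?thesis by (simp add: power2_commute)
  next
    case False
    then show ?thesis
      using le[of j i] that by (intro power_mono) auto
  qed
  have last: "(x N - x 1)\<^sup>2 < (y N - y 1)\<^sup>2"
    using le[of 1 N] less N by (intro power_strict_mono) auto
  have "(\<Sum>j = 1..N. (x N - x j)\<^sup>2) < (\<Sum>j = 1..N. (y N - y j)\<^sup>2)"
    using entry last N by (intro sum_strict_mono_ex1) auto
  then have "(\<Sum>i = 1..N. \<Sum>j = 1..N. (x i - x j)\<^sup>2) < (\<Sum>i = 1..N. \<Sum>j = 1..N. (y i - y j)\<^sup>2)"
    using entry N by (intro sum_strict_mono_ex1) (auto intro!: sum_mono bexI[of _ N])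
  then have "(real N)\<^sup>2 * var N x < (real N)\<^sup>2 * var N y"
    using N by (simp add: var_pairs)
  then show ?thesis
    using N by simp
qed

text \<open>A reflection preserves all distances, and reversing the indices only permutes the pairs.
  This serves to exchange the two walls \<open>0\<close> and \<open>A\<close>.\<close>

lemma var_reflect: "var N (\<lambda>n. a - x (N + 1 - n)) = var N x"
proof (cases "N = 0")
  case False
  have rev: "(\<Sum>n = 1..N. f (N + 1 - n)) = (\<Sum>n = 1..N. f n)" for f :: "nat \<Rightarrow> real"
    using sum.atLeastAtMost_rev[of f 1 N] by simp
  have "(\<Sum>i = 1..N. \<Sum>j = 1..N. (a - x (N + 1 - i) - (a - x (N + 1 - j)))\<^sup>2)
      = (\<Sum>i = 1..N. \<Sum>j = 1..N. (x (N + 1 - i) - x (N + 1 - j))\<^sup>2)"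
    by (intro sum.cong refl) (simp add: power2_commute)
  also have "\<dots> = (\<Sum>i = 1..N. \<Sum>j = 1..N. (x (N + 1 - i) - x j)\<^sup>2)"
    by (intro sum.cong refl rev)
  also have "\<dots> = (\<Sum>i = 1..N. \<Sum>j = 1..N. (x i - x j)\<^sup>2)"
    by (rule rev)
  finally have "(real N)\<^sup>2 * var N (\<lambda>n. a - x (N + 1 - n)) = (real N)\<^sup>2 * var N x"
    using False by (simp add: var_pairs)
  then show ?thesis using False by simp
qed (simp add: var_def mu_def)

text \<open>In the pairwise form the variance is a nonnegative quadratic form, hence convex along
  the segment from \<open>x\<close> to \<open>y\<close>.\<close>

lemma var_convex_le_max:
  assumes "0 \<le> s" "s \<le> 1"
  shows "var N (\<lambda>n. (1 - s) * x n + s * y n) \<le> max (var N x) (var N y)"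
proof (cases "N = 0")
  case False
  have sq: "((1 - s) * p + s * q)\<^sup>2 \<le> (1 - s) * p\<^sup>2 + s * q\<^sup>2" for p q :: real
  proof -
    have "(1 - s) * p\<^sup>2 + s * q\<^sup>2 - ((1 - s) * p + s * q)\<^sup>2 = s * (1 - s) * (p - q)\<^sup>2"
      by (simp add: power2_eq_square algebra_simps)
    moreover have "0 \<le> s * (1 - s) * (p - q)\<^sup>2"
      using assms by simp
    ultimately show ?thesis by linarith
  qed
  have "(\<Sum>i = 1..N. \<Sum>j = 1..N. ((1 - s) * x i + s * y i - ((1 - s) * x j + s * y j))\<^sup>2)
      \<le> (\<Sum>i = 1..N. \<Sum>j = 1..N. (1 - s) * (x i - x j)\<^sup>2 + s * (y i - y j)\<^sup>2)"
  proof (intro sum_mono)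
    fix i j
    show "((1 - s) * x i + s * y i - ((1 - s) * x j + s * y j))\<^sup>2
        \<le> (1 - s) * (x i - x j)\<^sup>2 + s * (y i - y j)\<^sup>2"
      using sq[of "x i - x j" "y i - y j"] by (simp add: algebra_simps)
  qed
  also have "\<dots> = (1 - s) * (\<Sum>i = 1..N. \<Sum>j = 1..N. (x i - x j)\<^sup>2)
      + s * (\<Sum>i = 1..N. \<Sum>j = 1..N. (y i - y j)\<^sup>2)"
    by (simp add: sum.distrib flip: sum_distrib_left)
  finally have "(real N)\<^sup>2 * var N (\<lambda>n. (1 - s) * x n + s * y n)
      \<le> (1 - s) * ((real N)\<^sup>2 * var N x) + s * ((real N)\<^sup>2 * var N y)"
    using False by (simp add: var_pairs)
  also have "\<dots> = (real N)\<^sup>2 * ((1 - s) * var N x + s * var N y)"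
    by (simp add: algebra_simps)
  finally have "var N (\<lambda>n. (1 - s) * x n + s * y n) \<le> (1 - s) * var N x + s * var N y"
    using False by simp
  also have "\<dots> \<le> max (var N x) (var N y)"
    using assms by (intro convex_bound_le) auto
  finally show ?thesis .
qed (simp add: var_def mu_def)

text \<open>The two windows of length \<open>N\<close> share the entries 2 to \<open>N\<close>, so
  the difference of the exchanged end entries factors out. The other factor compares the shared
  entries with the mean of the two ends.\<close>

lemma var_shift:
  assumes "N > 0"
  shows "(real N)\<^sup>2 * var N (\<lambda>n. z (Suc n)) - (real N)\<^sup>2 * var N z
    = (z (Suc N) - z 1) * (\<Sum>n = 2..N. z 1 + z (Suc N) - 2 * z n)"
proof -
  obtain K where K: "N = Suc K" using assms by (cases N) auto
  have head: "(\<Sum>n = 1..N. f n) = f 1 + (\<Sum>n = 2..N. f n)" for f :: "nat \<Rightarrow> real"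
    using assms by (simp add: sum.atLeast_Suc_atMost numeral_2_eq_2)
  have shift: "(\<Sum>n = 1..N. f (Suc n)) = (\<Sum>n = 2..N. f n) + f (Suc N)" for f :: "nat \<Rightarrow> real"
    using sum.shift_bounds_cl_Suc_ivl[of f 1 N] assms by (simp add: numeral_2_eq_2)
  define T where "T = (\<Sum>n = 2..N. z n)"
  define T2 where "T2 = (\<Sum>n = 2..N. (z n)\<^sup>2)"
  have "(real N)\<^sup>2 * var N (\<lambda>n. z (Suc n)) = real N * (T2 + (z (Suc N))\<^sup>2) - (T + z (Suc N))\<^sup>2"
    unfolding var_scaled[OF assms] T_def T2_def shift[of "\<lambda>n. (z n)\<^sup>2"] shift[of z] ..
  moreover have "(real N)\<^sup>2 * var N z = real N * ((z 1)\<^sup>2 + T2) - (z 1 + T)\<^sup>2"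
    unfolding var_scaled[OF assms] T_def T2_def head[of "\<lambda>n. (z n)\<^sup>2"] head[of z] ..
  moreover have "(\<Sum>n = 2..N. z 1 + z (Suc N) - 2 * z n) = real K * (z 1 + z (Suc N)) - 2 * T"
    by (simp add: T_def sum_subtractf K flip: sum_distrib_left)
  moreover have "real N = real K + 1" by (simp add: K)
  ultimately show ?thesis
    by (simp only:) (simp add: power2_eq_square algebra_simps)
qed

subsection \<open>Clipped ramps\<close>

definition clip :: "real \<Rightarrow> real \<Rightarrow> real" where
  "clip A t = max 0 (min A t)"

text \<open>\<open>\<tau>\<close> is the unclipped height at the fictitious index 0, so raising it
  by \<open>\<Delta>\<close> moves the index window by one, see \<open>ramp_Suc\<close>.\<close>

definition ramp :: "real \<Rightarrow> real \<Rightarrow> real \<Rightarrow> nat \<Rightarrow> real" where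
  "ramp A \<Delta> \<tau> n = clip A (\<tau> + real n * \<Delta>)"

lemma clip_mono: "s \<le> t \<Longrightarrow> clip A s \<le> clip A t"
  by (auto simp: clip_def)

text \<open>As the spread about \<open>p\<close> grows, the lower point reaches 0 no later than the
  upper one reaches \<open>A\<close>, because \<open>p\<close> is at most \<open>A / 2\<close>. So
  the upper point gains at least what the lower one loses.\<close>

lemma clip_pair_mono:
  assumes "2 * p \<le> A" "0 \<le> A" "\<bar>s\<bar> \<le> t"
  shows "clip A (p - s) + clip A (p + s) \<le> clip A (p - t) + clip A (p + t)"
  using assms by (auto simp: clip_def max_def min_def abs_if split: if_splits)

lemma clip_compl: "0 \<le> A \<Longrightarrow> A - clip A t = clip A (A - t)"
  by (auto simp: clip_def)

lemma clip_pair_antimono: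
  assumes "A \<le> 2 * p" "0 \<le> A" "\<bar>s\<bar> \<le> t"
  shows "clip A (p - t) + clip A (p + t) \<le> clip A (p - s) + clip A (p + s)"
  using clip_pair_mono[of "A - p" A s t] assms clip_compl[of A "p - t"] clip_compl[of A "p + t"]
    clip_compl[of A "p - s"] clip_compl[of A "p + s"]
  by (simp add: algebra_simps)

lemma ramp_Suc: "ramp A \<Delta> \<tau> (Suc n) = ramp A \<Delta> (\<tau> + \<Delta>) n"
  by (simp add: ramp_def algebra_simps)

text \<open>The shift exchanges sample 1 for sample \<open>N + 1\<close>. By
  \<open>var_shift\<close> it suffices that the shared samples lie on average at or below the mean
  of these two. Samples \<open>n\<close> and \<open>N + 2 - n\<close> are symmetric about the index
  \<open>(N + 2) / 2\<close>, whose unclipped height is at most \<open>A / 2\<close>, so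
  \<open>clip_pair_mono\<close> applies to each pair.\<close>

lemma ramp_shift_le:
  assumes "0 \<le> A" "0 < \<Delta>" "N > 0" "2 * \<tau> + real (N + 2) * \<Delta> \<le> A"
  shows "var N (ramp A \<Delta> \<tau>) \<le> var N (ramp A \<Delta> (\<tau> + \<Delta>))"
proof -
  let ?z = "ramp A \<Delta> \<tau>"
  have "2 * (\<Sum>n = 2..N. ?z n) = (\<Sum>n = 2..N. ?z n + ?z (N + 2 - n))"
    using sum.atLeastAtMost_rev[of ?z 2 N] by (simp add: sum.distrib)
  also have "\<dots> \<le> (\<Sum>n = 2..N. ?z 1 + ?z (Suc N))"
  proof (rule sum_mono)
    fix n assume n: "n \<in> {2..N}"
    then have "2 \<le> real n" "real n \<le> real N" by auto
    then have off: "\<bar>real n - real (N + 2) / 2\<bar> \<le> real N / 2"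
      by (simp add: abs_le_iff field_simps)
    have "\<bar>(real n - real (N + 2) / 2) * \<Delta>\<bar> \<le> real N / 2 * \<Delta>"
      unfolding abs_mult using off assms by (intro mult_mono) auto
    \<comment> \<open>The centre is the unclipped height at index \<open>(N + 2) / 2\<close>; the
      ends 1 and \<open>N + 1\<close> lie \<open>N / 2\<close> steps away from it, the shared
      samples no farther.\<close>
    from clip_pair_mono[of "\<tau> + real (N + 2) / 2 * \<Delta>" A, OF _ _ this] n assms
    show "?z n + ?z (N + 2 - n) \<le> ?z 1 + ?z (Suc N)"
      by (simp add: ramp_def algebra_simps of_nat_diff add_divide_distrib)
  qed
  finally have "0 \<le> (\<Sum>n = 2..N. ?z 1 + ?z (Suc N) - 2 * ?z n)"
    by (simp add: sum_subtractf sum_distrib_left)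
  moreover have "?z 1 \<le> ?z (Suc N)"
    unfolding ramp_def using assms by (intro clip_mono add_left_mono mult_right_mono) auto
  ultimately have "0 \<le> (real N)\<^sup>2 * var N (\<lambda>n. ?z (Suc n)) - (real N)\<^sup>2 * var N ?z"
    unfolding var_shift[OF \<open>N > 0\<close>] by simp
  then show ?thesis
    using assms by (simp add: ramp_Suc)
qed

text \<open>The same pairing with the centre at or above \<open>A / 2\<close>, where clipped pair
  sums do not grow with the spread.\<close>

lemma ramp_shift_ge:
  assumes "0 \<le> A" "0 < \<Delta>" "N > 0" "A \<le> 2 * \<tau> + real (N + 2) * \<Delta>"
  shows "var N (ramp A \<Delta> (\<tau> + \<Delta>)) \<le> var N (ramp A \<Delta> \<tau>)"
proof -
  let ?z = "ramp A \<Delta> \<tau>"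
  have "(\<Sum>n = 2..N. ?z 1 + ?z (Suc N)) \<le> (\<Sum>n = 2..N. ?z n + ?z (N + 2 - n))"
  proof (rule sum_mono)
    fix n assume n: "n \<in> {2..N}"
    then have "2 \<le> real n" "real n \<le> real N" by auto
    then have off: "\<bar>real n - real (N + 2) / 2\<bar> \<le> real N / 2"
      by (simp add: abs_le_iff field_simps)
    have "\<bar>(real n - real (N + 2) / 2) * \<Delta>\<bar> \<le> real N / 2 * \<Delta>"
      unfolding abs_mult using off assms by (intro mult_mono) auto
    from clip_pair_antimono[of A "\<tau> + real (N + 2) / 2 * \<Delta>", OF _ _ this] n assms
    show "?z 1 + ?z (Suc N) \<le> ?z n + ?z (N + 2 - n)"
      by (simp add: ramp_def algebra_simps of_nat_diff add_divide_distrib)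
  qed
  also have "\<dots> = 2 * (\<Sum>n = 2..N. ?z n)"
    using sum.atLeastAtMost_rev[of ?z 2 N] by (simp add: sum.distrib)
  finally have "(\<Sum>n = 2..N. ?z 1 + ?z (Suc N) - 2 * ?z n) \<le> 0"
    by (simp add: sum_subtractf sum_distrib_left)
  moreover have "?z 1 \<le> ?z (Suc N)"
    unfolding ramp_def using assms by (intro clip_mono add_left_mono mult_right_mono) auto
  ultimately have "(real N)\<^sup>2 * var N (\<lambda>n. ?z (Suc n)) - (real N)\<^sup>2 * var N ?z \<le> 0"
    unfolding var_shift[OF \<open>N > 0\<close>] by (intro mult_nonneg_nonpos) simp_all
  then show ?thesis
    using assms by (simp add: ramp_Suc)
qed

text \<open>The bounds on \<open>A\<close> say that the shift criterion changes at
  \<open>- L \<Delta>\<close>: a shift from \<open>- (L + 1) \<Delta>\<close> does not decrease the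
  variance, one from \<open>- L \<Delta>\<close> does not increase it. Along the grid the variance
  thus rises up to this point and falls after it.\<close>

lemma ramp_var_le_centred_int:
  fixes k L :: int
  assumes "0 \<le> A" "0 < \<Delta>" "N > 0"
    and "(real N - 2 * of_int L) * \<Delta> \<le> A" "A \<le> (real N + 2 - 2 * of_int L) * \<Delta>"
  shows "var N (ramp A \<Delta> (of_int k * \<Delta>)) \<le> var N (ramp A \<Delta> (- of_int L * \<Delta>))"
proof (cases "- L \<le> k")
  case True
  then show ?thesis
  proof (induction k rule: int_ge_induct)
    case (step i)
    \<comment> \<open>Added to the upper bound on \<open>A\<close>, this is the hypothesis of
      \<open>ramp_shift_ge\<close> at \<open>i \<Delta>\<close>.\<close>
    have "0 \<le> (2 * of_int i + 2 * of_int L) * \<Delta>"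
      using step.hyps assms by (intro mult_nonneg_nonneg) linarith+
    then have "var N (ramp A \<Delta> (of_int i * \<Delta> + \<Delta>)) \<le> var N (ramp A \<Delta> (of_int i * \<Delta>))"
      using assms by (intro ramp_shift_ge) (simp_all add: algebra_simps)
    with step.IH show ?case by (simp add: algebra_simps)
  qed simp
next
  case False
  then have "k \<le> - L" by simp
  then show ?thesis
  proof (induction k rule: int_le_induct)
    case (step i)
    \<comment> \<open>The shift starts at \<open>(i - 1) \<Delta>\<close>, where its criterion reads
      \<open>(2 i + N) \<Delta> \<le> A\<close>.\<close>
    have "0 \<le> (- 2 * of_int i - 2 * of_int L) * \<Delta>"
      using step.hyps assms by (intro mult_nonneg_nonneg) linarith+
    then have "var N (ramp A \<Delta> ((of_int i - 1) * \<Delta>)) \<le> var N (ramp A \<Delta> ((of_int i - 1) * \<Delta> + \<Delta>))"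
      using assms by (intro ramp_shift_le) (simp_all add: algebra_simps)
    with step.IH show ?case by (simp add: algebra_simps)
  qed simp
qed

text \<open>Reflection turns contact with \<open>A\<close> into contact with 0: intercepts in
  \<open>A\<close> plus multiples of \<open>\<Delta>\<close> become multiples of
  \<open>\<Delta>\<close>.\<close>

lemma ramp_reflect:
  assumes "0 \<le> A"
  shows "var N (ramp A \<Delta> (A + \<tau>)) = var N (ramp A \<Delta> (- \<tau> - real (N + 1) * \<Delta>))"
proof -
  have "var N (ramp A \<Delta> (A + \<tau>)) = var N (\<lambda>n. A - ramp A \<Delta> (A + \<tau>) (N + 1 - n))"
    by (rule var_reflect[symmetric])
  also have "\<dots> = var N (ramp A \<Delta> (- \<tau> - real (N + 1) * \<Delta>))"
    by (rule var_cong) (auto simp: ramp_def clip_compl assms of_nat_diff algebra_simps)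
  finally show ?thesis .
qed

lemma ramp_var_le_centred:
  fixes L :: int
  assumes "0 \<le> A" "0 < \<Delta>" "N > 0"
    and "(real N - 2 * of_int L) * \<Delta> \<le> A" "A \<le> (real N + 2 - 2 * of_int L) * \<Delta>"
  shows "var N (ramp A \<Delta> \<tau>) \<le> var N (ramp A \<Delta> (- of_int L * \<Delta>))" (is "_ \<le> ?V")
proof -
  have grid: "var N (ramp A \<Delta> (of_int k * \<Delta>)) \<le> ?V" for k :: int
    using assms by (rule ramp_var_le_centred_int)
  have grid': "var N (ramp A \<Delta> (A + of_int k * \<Delta>)) \<le> ?V" for k :: int
    using grid[of "- k - int N - 1"] assms by (simp add: ramp_reflect algebra_simps)
  \<comment> \<open>The breakpoints are the multiples of \<open>\<Delta>\<close> and their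
    translates by \<open>A\<close>. Below, \<open>a\<close> is the last one not exceeding
    \<open>\<tau>\<close> and \<open>b\<close> the next one above \<open>\<tau>\<close>.\<close>
  define k where "k = \<lfloor>\<tau> / \<Delta>\<rfloor>"
  define l where "l = \<lfloor>(\<tau> - A) / \<Delta>\<rfloor>"
  have k: "of_int k * \<Delta> \<le> \<tau>" "\<tau> < (of_int k + 1) * \<Delta>"
    using floor_correct[of "\<tau> / \<Delta>", folded k_def] assms
    by (simp_all add: pos_le_divide_eq pos_divide_less_eq)
  have l: "of_int l * \<Delta> \<le> \<tau> - A" "\<tau> - A < (of_int l + 1) * \<Delta>"
    using floor_correct[of "(\<tau> - A) / \<Delta>", folded l_def] assms
    by (simp_all add: pos_le_divide_eq pos_divide_less_eq)
  define a where "a = max (of_int k * \<Delta>) (A + of_int l * \<Delta>)"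
  define b where "b = min (of_int (k + 1) * \<Delta>) (A + of_int (l + 1) * \<Delta>)"
  have ab: "a \<le> \<tau>" "\<tau> < b"
    using k l by (auto simp: a_def b_def)
  define s where "s = (\<tau> - a) / (b - a)"
  have s: "0 \<le> s" "s \<le> 1" using ab by (auto simp: s_def)
  have \<tau>: "\<tau> = (1 - s) * a + s * b"
  proof -
    have "s * (b - a) = \<tau> - a" using ab by (simp add: s_def)
    then show ?thesis by (simp add: algebra_simps)
  qed
  \<comment> \<open>No integer lies strictly between \<open>m\<close> and \<open>m + 1\<close>, so a
    height measured from a wall keeps its sign over the cell; used with \<open>k\<close> for the
    wall 0 and with \<open>l\<close> for the wall \<open>A\<close>.\<close>
  have sign: "of_int m * \<Delta> \<ge> 0 \<or> of_int (m + 1) * \<Delta> \<le> 0" for m :: int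
  proof (cases "0 \<le> m")
    case False
    then have "of_int (m + 1) \<le> (0::real)" by linarith
    then show ?thesis using assms by (intro disjI2 mult_nonpos_nonneg) auto
  qed (use assms in simp)
  \<comment> \<open>No kink of \<open>clip\<close> lies strictly between two neighbouring breakpoints, so there the ramp is affine in \<open>\<tau>\<close>.\<close>
  have affine: "ramp A \<Delta> \<tau> n = (1 - s) * ramp A \<Delta> a n + s * ramp A \<Delta> b n" for n
  proof -
    let ?t = "real n * \<Delta>"
    have zero: "0 \<le> a + ?t \<or> b + ?t \<le> 0"
      using sign[of "k + int n"] by (auto simp: a_def b_def algebra_simps)
    have top: "A \<le> a + ?t \<or> b + ?t \<le> A"
      using sign[of "l + int n"] by (auto simp: a_def b_def algebra_simps)
    consider "b + ?t \<le> 0" | "A \<le> a + ?t" | "0 \<le> a + ?t" "b + ?t \<le> A"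
      using zero top by blast
    then show ?thesis
    proof cases
      case 3
      then have "clip A (a + ?t) = a + ?t" "clip A (b + ?t) = b + ?t" "clip A (\<tau> + ?t) = \<tau> + ?t"
        using ab assms by (auto simp: clip_def)
      then show ?thesis
        unfolding ramp_def by (simp add: \<tau> algebra_simps)
    next
      case 1
      then have "clip A (a + ?t) = 0" "clip A (b + ?t) = 0" "clip A (\<tau> + ?t) = 0"
        using ab assms by (auto simp: clip_def)
      then show ?thesis by (simp add: ramp_def)
    next
      case 2
      then have "clip A (a + ?t) = A" "clip A (b + ?t) = A" "clip A (\<tau> + ?t) = A"
        using ab assms by (auto simp: clip_def)
      then show ?thesis by (simp add: ramp_def algebra_simps)
    qed
  qed
  have "var N (ramp A \<Delta> \<tau>) \<le> max (var N (ramp A \<Delta> a)) (var N (ramp A \<Delta> b))"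
    using var_convex_le_max[OF s, of N "ramp A \<Delta> a" "ramp A \<Delta> b"] affine
    by (simp cong: var_cong)
  moreover have "var N (ramp A \<Delta> a) \<le> ?V"
    using grid[of k] grid'[of l] unfolding a_def max_def by auto
  moreover have "var N (ramp A \<Delta> b) \<le> ?V"
    using grid[of "k + 1"] grid'[of "l + 1"] unfolding b_def min_def by auto
  ultimately show ?thesis by simp
qed

subsection \<open>Reduction of feasible paths to ramps\<close>

lemma var_le_if_same_sum:
  assumes "(\<Sum>n = 1..N. x n) = (\<Sum>n = 1..N. y n)" "(\<Sum>n = 1..N. (x n)\<^sup>2) \<le> (\<Sum>n = 1..N. (y n)\<^sup>2)"
  shows "var N x \<le> var N y"
  using assms by (simp add: var_def mu_def divide_right_mono)

text \<open>The sum is continuous in \<open>\<tau>\<close> and runs from 0, with all samples clipped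
  at 0, to \<open>N A\<close>, with all at \<open>A\<close>.\<close>

lemma sum_ramp_surj:
  assumes "0 < A" "0 < \<Delta>" "0 \<le> S" "S \<le> real N * A"
  obtains \<tau> where "(\<Sum>n = 1..N. ramp A \<Delta> \<tau> n) = S"
proof -
  let ?g = "\<lambda>\<tau>. \<Sum>n = 1..N. ramp A \<Delta> \<tau> n"
  have "ramp A \<Delta> (- real N * \<Delta>) n = 0" if "n \<in> {1..N}" for n
  proof -
    have "real n * \<Delta> \<le> real N * \<Delta>" using that assms by simp
    then have "- real N * \<Delta> + real n * \<Delta> \<le> 0" by simp
    then show ?thesis unfolding ramp_def clip_def by linarith
  qed
  then have low: "?g (- real N * \<Delta>) = 0" by simp
  have "ramp A \<Delta> A n = A" for n
    using assms by (simp add: ramp_def clip_def)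
  then have high: "?g A = real N * A" by simp
  have "continuous_on {- real N * \<Delta>..A} ?g"
    unfolding ramp_def clip_def by (intro continuous_intros)
  moreover have "- real N * \<Delta> \<le> A"
    using assms mult_nonneg_nonneg[of "real N" \<Delta>] by linarith
  ultimately obtain \<tau> where "?g \<tau> = S"
    using IVT'[of ?g "- real N * \<Delta>" S A] low high assms by auto
  then show ?thesis by (rule that)
qed

text \<open>
  The ramp with the same sum crosses \<open>x\<close> only once, from below to above, and therefore
  majorizes it.
\<close>

lemma mono_var_le_ramp:
  assumes A: "0 < A" "0 < \<Delta>"
    and box: "\<And>n. n \<in> {1..N} \<Longrightarrow> 0 \<le> x n \<and> x n \<le> A"
    and mono: "\<And>i j. 1 \<le> i \<Longrightarrow> i \<le> j \<Longrightarrow> j \<le> N \<Longrightarrow> x i \<le> x j"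
    and gap: "\<And>n. 1 \<le> n \<Longrightarrow> n < N \<Longrightarrow> x (Suc n) - x n \<le> \<Delta>"
  obtains \<tau> where "var N x \<le> var N (ramp A \<Delta> \<tau>)"
proof -
  have "(\<Sum>n = 1..N. x n) \<le> real N * A"
    using sum_bounded_above[of "{1..N}" x A] box by simp
  moreover have "0 \<le> (\<Sum>n = 1..N. x n)"
    by (intro sum_nonneg) (use box in blast)
  ultimately obtain \<tau> where \<tau>: "(\<Sum>n = 1..N. ramp A \<Delta> \<tau> n) = (\<Sum>n = 1..N. x n)"
    using sum_ramp_surj[OF A] by blast
  define y where "y = ramp A \<Delta> \<tau>"
  have slope: "x j \<le> x i + real (j - i) * \<Delta>" if "1 \<le> i" "i \<le> j" "j \<le> N" for i j
    using \<open>i \<le> j\<close> \<open>j \<le> N\<close>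
  proof (induction j rule: dec_induct)
    case (step m)
    then show ?case
      using gap[of m] \<open>1 \<le> i\<close> by (simp add: Suc_diff_le algebra_simps)
  qed simp
  \<comment> \<open>Once the ramp is above \<open>x\<close>, its unclipped line climbs by
    \<open>\<Delta>\<close> per step and \<open>x\<close> by no more; clipping at \<open>A\<close>
    does no harm since \<open>x \<le> A\<close>.\<close>
  have cross: "x j \<le> y j" if "1 \<le> i" "i \<le> j" "j \<le> N" "x i < y i" for i j
  proof -
    have "0 \<le> x i" "x j \<le> A" using box that by auto
    moreover have "real j * \<Delta> = real i * \<Delta> + real (j - i) * \<Delta>"
      using that by (simp add: of_nat_diff algebra_simps)
    ultimately show ?thesis
      using slope[OF that(1-3)] that(4) by (auto simp: y_def ramp_def clip_def)
  qed
  \<comment> \<open>With \<open>i\<close> the first index at which the ramp exceeds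
    \<open>x\<close>, the signs of \<open>x n - x i\<close> and \<open>y n - x n\<close> are never
    opposite. So the weight \<open>x n\<close> may be lowered to the constant \<open>x i\<close>,
    for which the sum vanishes because the totals agree.\<close>
  have "0 \<le> (\<Sum>n = 1..N. x n * (y n - x n))"
  proof (cases "\<exists>i\<in>{1..N}. x i < y i")
    case True
    then obtain i where i: "i \<in> {1..N}" "x i < y i"
      and least: "\<And>j. j \<in> {1..N} \<Longrightarrow> x j < y j \<Longrightarrow> i \<le> j"
      using exists_least_iff[of "\<lambda>i. i \<in> {1..N} \<and> x i < y i"] by (metis not_less)
    have "x i * (y n - x n) \<le> x n * (y n - x n)" if n: "n \<in> {1..N}" for n
    proof (cases "i \<le> n")
      case True
      then show ?thesis
        using mono[of i n] cross[of i n] i n by (intro mult_right_mono) auto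
    next
      case False
      then show ?thesis
        using mono[of n i] least[OF n] i n by (intro mult_right_mono_neg) force+
    qed
    then have "(\<Sum>n = 1..N. x i * (y n - x n)) \<le> (\<Sum>n = 1..N. x n * (y n - x n))"
      by (rule sum_mono)
    moreover have "(\<Sum>n = 1..N. x i * (y n - x n)) = 0"
      unfolding sum_distrib_left[symmetric] sum_subtractf y_def \<tau> by simp
    ultimately show ?thesis by simp
  next
    case False
    \<comment> \<open>Here \<open>y \<le> x\<close> throughout with equal totals, which forces
      \<open>y = x\<close>.\<close>
    have "(\<Sum>n = 1..N. x n - y n) = 0"
      using \<tau> by (simp add: y_def sum_subtractf)
    then have "\<forall>n\<in>{1..N}. x n - y n = 0"
      using False by (subst (asm) sum_nonneg_eq_0_iff) force+
    then show ?thesis by (intro sum_nonneg) simp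
  qed
  moreover have "(\<Sum>n = 1..N. (x n)\<^sup>2) + 2 * (\<Sum>n = 1..N. x n * (y n - x n)) + (\<Sum>n = 1..N. (y n - x n)\<^sup>2)
      = (\<Sum>n = 1..N. (y n)\<^sup>2)"
    unfolding sum_distrib_left sum.distrib[symmetric]
    by (intro sum.cong) (auto simp: power2_eq_square algebra_simps)
  moreover have "0 \<le> (\<Sum>n = 1..N. (y n - x n)\<^sup>2)"
    by (simp add: sum_nonneg)
  ultimately have "(\<Sum>n = 1..N. (x n)\<^sup>2) \<le> (\<Sum>n = 1..N. (y n)\<^sup>2)"
    by linarith
  with \<tau> have "var N x \<le> var N (ramp A \<Delta> \<tau>)"
    by (intro var_le_if_same_sum) (auto simp: y_def)
  then show ?thesis by (rule that)
qed

text \<open>Sorting keeps the multiset of values and with it the variance. Two consecutive sorted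
  values more than \<open>\<Delta>\<close> apart would split the path into a low and a high group
  that its steps cannot connect.\<close>

lemma sorted_rearrangement:
  fixes x :: "nat \<Rightarrow> real"
  assumes gap: "\<And>n. 1 \<le> n \<Longrightarrow> n < N \<Longrightarrow> \<bar>x (Suc n) - x n\<bar> \<le> \<Delta>"
  obtains y where "\<And>i j. 1 \<le> i \<Longrightarrow> i \<le> j \<Longrightarrow> j \<le> N \<Longrightarrow> y i \<le> y j"
    and "\<And>n. 1 \<le> n \<Longrightarrow> n < N \<Longrightarrow> y (Suc n) - y n \<le> \<Delta>"
    and "y ` {1..N} = x ` {1..N}"
    and "var N y = var N x"
proof -
  define xs where "xs = sort (map x [1..<Suc N])"
  define y where "y n = xs ! (n - 1)" for n
  have len: "length xs = N" by (simp add: xs_def)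
  have mono: "y i \<le> y j" if "1 \<le> i" "i \<le> j" "j \<le> N" for i j
    unfolding y_def by (rule sorted_nth_mono) (use that len in \<open>auto simp: xs_def\<close>)
  have "y ` {1..N} = set xs"
  proof -
    have "{..<N} = (\<lambda>n. n - 1) ` {1..N}"
      by (auto simp: image_iff intro!: bexI[where x = "Suc _"])
    then have "y ` {1..N} = (\<lambda>i. xs ! i) ` {..<N}"
      by (simp add: y_def image_image)
    also have "\<dots> = set xs"
      by (auto simp: set_conv_nth len)
    finally show ?thesis .
  qed
  also have set: "set xs = x ` {1..N}"
    by (auto simp: xs_def)
  finally have img: "y ` {1..N} = x ` {1..N}" .
  have sum: "(\<Sum>n = 1..N. f (y n)) = (\<Sum>n = 1..N. f (x n))" for f :: "real \<Rightarrow> real"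
  proof -
    have "(\<Sum>n = 1..N. f (y n)) = (\<Sum>i = 0..<N. f (xs ! i))"
      unfolding y_def by (rule sum.reindex_bij_witness[of _ Suc "\<lambda>n. n - 1"]) auto
    also have "\<dots> = sum_list (map f xs)"
      by (simp add: sum_list_sum_nth len)
    also have "\<dots> = \<Sum>\<^sub># (image_mset f (mset xs))"
      unfolding mset_map[symmetric] sum_mset_sum_list ..
    also have "mset xs = image_mset x (mset_set {1..N})"
      by (simp add: xs_def atLeastLessThanSuc_atLeastAtMost del: upt_Suc)
    also have "\<Sum>\<^sub># (image_mset f (image_mset x (mset_set {1..N}))) = (\<Sum>n = 1..N. f (x n))"
      by (simp add: sum_unfold_sum_mset image_mset.compositionality comp_def)
    finally show ?thesis .
  qed
  have "var N y = var N x"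
    using sum[of "\<lambda>t. t"] sum[of power2] by (simp add: var_def mu_def)
  moreover have "y (Suc n) - y n \<le> \<Delta>" if n: "1 \<le> n" "n < N" for n
  proof (rule ccontr)
    assume "\<not> ?thesis"
    then have jump: "y n + \<Delta> < y (Suc n)" by simp
    have split: "x i \<le> y n \<or> y (Suc n) \<le> x i" if "i \<in> {1..N}" for i
    proof -
      have "x i \<in> y ` {1..N}" unfolding img using that by (rule imageI)
      then obtain k where k: "k \<in> {1..N}" "x i = y k" by blast
      then show ?thesis
        using mono[of k n] mono[of "Suc n" k] n by (cases "k \<le> n") auto
    qed
    \<comment> \<open>The whole path stays in the group of its first point, as no step of length at
      most \<open>\<Delta>\<close> crosses the jump.\<close>
    have "x i \<le> y n \<longleftrightarrow> x 1 \<le> y n" if "1 \<le> i" "i \<le> N" for i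
      using that
    proof (induction i rule: dec_induct)
      case (step m)
      then show ?case
        using gap[of m] jump split[of m] split[of "Suc m"] by (auto simp: abs_le_iff)
    qed simp
    note low = this
    have "y n \<in> x ` {1..N}" "y (Suc n) \<in> x ` {1..N}"
      unfolding img[symmetric] using n by auto
    then obtain a b where "a \<in> {1..N}" "x a = y n" "b \<in> {1..N}" "x b = y (Suc n)"
      by (metis imageE)
    moreover have "0 \<le> \<Delta>" using gap[OF n] by linarith
    ultimately show False using jump low[of a] low[of b] by auto
  qed
  ultimately show ?thesis using that mono img by blast
qed

lemma var_le_centred_ramp:
  fixes L :: int
  assumes A: "0 < A" "0 < \<Delta>" and N: "N > 0"
    and L: "(real N - 2 * of_int L) * \<Delta> \<le> A" "A \<le> (real N + 2 - 2 * of_int L) * \<Delta>"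
    and box: "\<And>n. n \<in> {1..N} \<Longrightarrow> 0 \<le> x n \<and> x n \<le> A"
    and gap: "\<And>n. 1 \<le> n \<Longrightarrow> n < N \<Longrightarrow> \<bar>x (Suc n) - x n\<bar> \<le> \<Delta>"
  shows "var N x \<le> var N (ramp A \<Delta> (- of_int L * \<Delta>))"
proof -
  obtain y where y: "\<And>i j. 1 \<le> i \<Longrightarrow> i \<le> j \<Longrightarrow> j \<le> N \<Longrightarrow> y i \<le> y j"
    "\<And>n. 1 \<le> n \<Longrightarrow> n < N \<Longrightarrow> y (Suc n) - y n \<le> \<Delta>"
    "y ` {1..N} = x ` {1..N}" "var N y = var N x"
    using sorted_rearrangement[of N x \<Delta>] gap by metis
  have "0 \<le> y n \<and> y n \<le> A" if "n \<in> {1..N}" for n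
    using y(3) box that by (metis imageE imageI)
  then obtain \<tau> where "var N y \<le> var N (ramp A \<Delta> \<tau>)"
    using mono_var_le_ramp[OF A, of N y] y by metis
  also have "\<dots> \<le> var N (ramp A \<Delta> (- of_int L * \<Delta>))"
    using A N L by (intro ramp_var_le_centred) auto
  finally show ?thesis by (simp add: y)
qed

text \<open>Together with \<open>feasibleI\<close> this eliminates the velocities: feasibility of
  the positions amounts to the box and a bound on the increments.\<close>

lemma feasible_gap:
  assumes "feasible A vm Ts N (x, v)" "0 < Ts" "1 \<le> n" "n < N"
  shows "\<bar>x (Suc n) - x n\<bar> \<le> vm * Ts"
proof -
  \<comment> \<open>Feasibility gives the formula from index 2 on; at index 1 the sum is
    empty.\<close>
  have x: "x m = x 1 + Ts * (\<Sum>m = 1..m - 1. v m)" if "1 \<le> m" "m \<le> N" for m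
    using assms that by (cases "m = 1") (auto simp: feasible_def)
  have "x (Suc n) - x n = Ts * v n"
    using x[of n] x[of "Suc n"] assms by (cases n) (auto simp: algebra_simps)
  moreover have "\<bar>v n\<bar> \<le> vm"
  proof -
    have "n \<in> {1..N - 1}" using assms(3,4) by auto
    then have "- vm \<le> v n \<and> v n \<le> vm"
      using assms(1) unfolding feasible_def by blast
    then show ?thesis by linarith
  qed
  ultimately show ?thesis
    using assms by (simp add: abs_mult mult.commute)
qed

lemma feasibleI:
  assumes "0 < Ts"
    and box: "\<And>n. n \<in> {1..N} \<Longrightarrow> 0 \<le> x n \<and> x n \<le> A"
    and gap: "\<And>n. 1 \<le> n \<Longrightarrow> n < N \<Longrightarrow> \<bar>x (Suc n) - x n\<bar> \<le> vm * Ts"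
    and v: "\<And>n. 1 \<le> n \<Longrightarrow> n < N \<Longrightarrow> v n = (x (Suc n) - x n) / Ts"
  shows "feasible A vm Ts N (x, v)"
proof -
  have "\<bar>v n\<bar> \<le> vm" if "1 \<le> n" "n < N" for n
    using gap[OF that] v[OF that] \<open>0 < Ts\<close> by (simp add: pos_divide_le_eq)
  moreover have position: "x n = x 1 + Ts * (\<Sum>m = 1..n - 1. v m)" if "1 \<le> n" "n \<le> N" for n
    using that
  proof (induction n rule: dec_induct)
    case (step m)
    have "x (Suc m) = x m + Ts * v m"
      using v[of m] step \<open>0 < Ts\<close> by simp
    moreover have "(\<Sum>k = 1..m. v k) = (\<Sum>k = 1..m - 1. v k) + v m"
      using step by (cases m) auto
    ultimately show ?case
      using step by (simp add: algebra_simps)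
  qed simp
  ultimately show ?thesis
    unfolding feasible_def prod.case
  proof (intro conjI ballI)
    fix n assume "n \<in> {1..N - 1}"
    then have "\<bar>v n\<bar> \<le> vm"
      using \<open>\<And>n. 1 \<le> n \<Longrightarrow> n < N \<Longrightarrow> \<bar>v n\<bar> \<le> vm\<close>[of n] by auto
    then show "- vm \<le> v n" "v n \<le> vm" by linarith+
  next
    fix n assume n: "n \<in> {1..N}"
    show "0 \<le> x n" "x n \<le> A" using box[OF n] by blast+
  next
    fix n assume "n \<in> {2..N}"
    then have "1 \<le> n" "n \<le> N" by auto
    then show "x n = x 1 + Ts * (\<Sum>m = 1..n - 1. v m)"
      using position by blast
  qed
qed

subsection \<open>The space-constrained path\<close>

text \<open>From \<open>0 < A / \<Delta> < N - 1\<close> the integer \<open>N_M\<close> lies between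
  0 and \<open>N - 2\<close>. Hence at least two samples remain, and they are halved between the two
  walls, the odd one going to the left.\<close>

lemma SC_counts:
  assumes "0 < A" "0 < \<Delta>" "A < (real N - 1) * \<Delta>"
  obtains L M R :: nat where "N_L \<Delta> N A = int L" "N_M \<Delta> A = int M" "N_R \<Delta> N A = int R"
    and "N = L + M + R" "1 \<le> R" "R \<le> L" "L \<le> R + 1"
    and "real M * \<Delta> < A" "A \<le> (real M + 1) * \<Delta>"
proof -
  define m where "m = \<lceil>A / \<Delta>\<rceil> - 1"
  have "0 < A / \<Delta>" using assms by simp
  moreover have "A / \<Delta> < real N - 1" using assms by (simp add: pos_divide_less_eq)
  moreover have m: "of_int m < A / \<Delta>" "A / \<Delta> \<le> of_int m + 1"
    unfolding m_def by linarith+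
  ultimately have "0 \<le> m" "m + 2 \<le> int N"
    by linarith+
  define d where "d = int N - m"
  have d: "(real N - of_int m) / 2 = of_int d / of_int 2"
    by (simp add: d_def)
  have NM: "N_M \<Delta> A = m"
    by (simp add: N_M_def m_def)
  \<comment> \<open>For integer \<open>d\<close> this is the ceiling of \<open>d / 2\<close>, as
    \<open>div\<close> rounds down.\<close>
  have NL: "N_L \<Delta> N A = - ((- d) div 2)"
    unfolding N_L_def NM d by (rule ceiling_divide_eq_div)
  have NR: "N_R \<Delta> N A = d div 2"
    unfolding N_R_def NM d by (rule floor_divide_of_int_eq)
  have "2 \<le> d" using \<open>m + 2 \<le> int N\<close> by (simp add: d_def)
  then have div: "- ((- d) div 2) + d div 2 = d" "1 \<le> d div 2" "d div 2 \<le> - ((- d) div 2)"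
    "- ((- d) div 2) \<le> d div 2 + 1"
    by linarith+
  show ?thesis
  proof (rule that[of "nat (- ((- d) div 2))" "nat m" "nat (d div 2)"])
    show "N_L \<Delta> N A = int (nat (- ((- d) div 2)))" "N_M \<Delta> A = int (nat m)"
      "N_R \<Delta> N A = int (nat (d div 2))"
      using NL NM NR div \<open>0 \<le> m\<close> by auto
    show "N = nat (- ((- d) div 2)) + nat m + nat (d div 2)"
      using div \<open>0 \<le> m\<close> d_def by linarith
    show "real (nat m) * \<Delta> < A" "A \<le> (real (nat m) + 1) * \<Delta>"
      using m assms \<open>0 \<le> m\<close> by (simp_all add: pos_less_divide_eq pos_divide_le_eq)
  qed (use div in linarith)+
qed

lemma x_SC_cases:
  assumes "N_L (vm * Ts) N A = int L" "N_R (vm * Ts) N A = int R" "N = L + M + R"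
  shows "x_SC vm Ts N A n =
    (if n \<le> L then 0 else if n \<le> L + M then real (n - L) * (vm * Ts) else A)"
  using assms by (auto simp: x_SC_def Let_def of_nat_diff)

text \<open>With intercept \<open>- L \<Delta>\<close> the first \<open>L\<close> samples are
  clipped to 0, the next \<open>M\<close> stay inside because \<open>M \<Delta> < A\<close>, and
  from index \<open>L + M + 1\<close> on the height is at least \<open>(M + 1) \<Delta>\<close>,
  hence clipped to \<open>A\<close>. This holds also beyond index \<open>N\<close>.\<close>

lemma x_SC_eq_ramp:
  assumes "N_L (vm * Ts) N A = int L" "N_R (vm * Ts) N A = int R" "N = L + M + R"
    and "0 < vm * Ts" "0 < A"
    and "real M * (vm * Ts) < A" "A \<le> (real M + 1) * (vm * Ts)"
  shows "x_SC vm Ts N A n = ramp A (vm * Ts) (- of_int (int L) * (vm * Ts)) n"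
proof -
  let ?\<Delta> = "vm * Ts"
  consider "n \<le> L" | "L < n" "n \<le> L + M" | "L + M + 1 \<le> n" by linarith
  then show ?thesis
  proof cases
    case 1
    then have "real n * ?\<Delta> \<le> real L * ?\<Delta>"
      using assms(4) by (intro mult_right_mono) auto
    then show ?thesis
      using 1 assms(5) unfolding x_SC_cases[OF assms(1-3)] ramp_def clip_def by auto
  next
    case 2
    have "real (n - L) * ?\<Delta> \<le> real M * ?\<Delta>"
      using 2 assms(4) by (intro mult_right_mono) auto
    moreover have "- of_int (int L) * ?\<Delta> + real n * ?\<Delta> = real (n - L) * ?\<Delta>"
      using 2 by (simp add: of_nat_diff algebra_simps)
    moreover have "0 \<le> real (n - L) * ?\<Delta>"
      by (intro mult_nonneg_nonneg of_nat_0_le_iff less_imp_le[OF assms(4)])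
    ultimately show ?thesis
      using 2 assms unfolding x_SC_cases[OF assms(1-3)] ramp_def clip_def max_def min_def by auto
  next
    case 3
    have "(real M + 1) * ?\<Delta> \<le> real (n - L) * ?\<Delta>"
      using 3 assms(4) by (intro mult_right_mono) (auto simp: of_nat_diff)
    moreover have "- of_int (int L) * ?\<Delta> + real n * ?\<Delta> = real (n - L) * ?\<Delta>"
      using 3 by (simp add: of_nat_diff algebra_simps)
    ultimately show ?thesis
      using 3 assms unfolding x_SC_cases[OF assms(1-3)] ramp_def clip_def max_def min_def by auto
  qed
qed

section \<open>Feasibility, optimality and variance of the path\<close>

context
  fixes N :: nat and A vm Ts \<Delta> :: real
  assumes pos: "0 < A" "0 < vm" "0 < Ts" and \<Delta>: "\<Delta> = vm * Ts"
    and constrained: "A < (real N - 1) * \<Delta>"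
begin

lemma \<Delta>_pos: "0 < \<Delta>"
  using pos \<Delta> by simp

lemma x_SC_is_ramp:
  obtains \<tau> where "\<And>n. x_SC vm Ts N A n = ramp A \<Delta> \<tau> n"
proof -
  obtain L M R :: nat where "N_L \<Delta> N A = int L" "N_R \<Delta> N A = int R" "N = L + M + R"
    "real M * \<Delta> < A" "A \<le> (real M + 1) * \<Delta>"
    using SC_counts[OF pos(1) \<Delta>_pos constrained] by metis
  then show ?thesis
    using that x_SC_eq_ramp[of vm Ts N A L R M] \<Delta>_pos pos(1) unfolding \<Delta> by metis
qed

lemma x_SC_bounds: "0 \<le> x_SC vm Ts N A n" "x_SC vm Ts N A n \<le> A"
proof -
  obtain \<tau> where "x_SC vm Ts N A n = ramp A \<Delta> \<tau> n" using x_SC_is_ramp by metis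
  then show "0 \<le> x_SC vm Ts N A n" "x_SC vm Ts N A n \<le> A"
    using pos by (auto simp: ramp_def clip_def)
qed

lemma x_SC_mono:
  assumes "m \<le> n"
  shows "x_SC vm Ts N A m \<le> x_SC vm Ts N A n"
proof -
  obtain \<tau> where "\<And>n. x_SC vm Ts N A n = ramp A \<Delta> \<tau> n" using x_SC_is_ramp by metis
  then show ?thesis
    using assms \<Delta>_pos by (auto simp: ramp_def intro!: clip_mono)
qed

lemma x_SC_gap: "\<bar>x_SC vm Ts N A (Suc n) - x_SC vm Ts N A n\<bar> \<le> \<Delta>"
proof -
  obtain \<tau> where \<tau>: "\<And>n. x_SC vm Ts N A n = ramp A \<Delta> \<tau> n" using x_SC_is_ramp by metis
  have "\<bar>clip A (t + \<Delta>) - clip A t\<bar> \<le> \<Delta>" for t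
    using \<Delta>_pos by (auto simp: clip_def)
  from this[of "\<tau> + real n * \<Delta>"] show ?thesis
    by (simp add: \<tau> ramp_def algebra_simps)
qed

lemma x_SC_ends: "x_SC vm Ts N A 1 = 0" "x_SC vm Ts N A N = A"
proof -
  obtain L M R :: nat where c: "N_L \<Delta> N A = int L" "N_R \<Delta> N A = int R" "N = L + M + R"
    "1 \<le> R" "R \<le> L"
    using SC_counts[OF pos(1) \<Delta>_pos constrained] by metis
  then show "x_SC vm Ts N A 1 = 0" "x_SC vm Ts N A N = A"
    using x_SC_cases[of vm Ts N A L R M] \<Delta> by auto
qed

lemma N_ge_2: "2 \<le> N"
proof -
  have "0 < (real N - 1) * \<Delta>" using pos constrained by linarith
  then show ?thesis using \<Delta>_pos by (simp add: zero_less_mult_iff)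
qed

lemma feasible_SC: "feasible A vm Ts N (x_SC vm Ts N A, v_SC vm Ts N A)"
proof (rule feasibleI)
  fix n assume n: "1 \<le> n" "n < N"
  obtain L M R :: nat where c: "N_L (vm * Ts) N A = int L" "N_M (vm * Ts) A = int M"
    "N_R (vm * Ts) N A = int R" "N = L + M + R"
    using SC_counts[OF pos(1) \<Delta>_pos constrained] \<Delta> by metis
  have v: "v_SC vm Ts N A n = (if n < L then 0 else if n < L + M then vm
      else if n = L + M then (A - real M * (vm * Ts)) / Ts else 0)"
    using c by (auto simp: v_SC_def Let_def)
  show "v_SC vm Ts N A n = (x_SC vm Ts N A (Suc n) - x_SC vm Ts N A n) / Ts"
    \<comment> \<open>The only partial step, of length \<open>A - M \<Delta>\<close>, leaves index
      \<open>L + M\<close>; for \<open>M = 0\<close> it starts from the wall 0.\<close>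
    unfolding v x_SC_cases[OF c(1,3,4)] using pos
    by (auto simp: of_nat_diff Suc_diff_le algebra_simps not_less le_Suc_eq)
qed (use pos x_SC_bounds x_SC_gap \<Delta> in auto)

lemma var_le_var_SC:
  assumes "feasible A vm Ts N (x, v)"
  shows "var N x \<le> var N (x_SC vm Ts N A)"
proof -
  obtain L M R :: nat where c: "N_L (vm * Ts) N A = int L" "N_R (vm * Ts) N A = int R"
    "N = L + M + R" "R \<le> L" "L \<le> R + 1" "real M * (vm * Ts) < A" "A \<le> (real M + 1) * (vm * Ts)"
    using SC_counts[OF pos(1) \<Delta>_pos constrained] \<Delta> by metis
  \<comment> \<open>Since \<open>N - 2 L = M + R - L\<close>, the balance
    \<open>R \<le> L \<le> R + 1\<close> places \<open>A\<close>, which lies between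
    \<open>M \<Delta>\<close> and \<open>(M + 1) \<Delta>\<close>, in the range that makes
    \<open>- L \<Delta>\<close> the best intercept.\<close>
  have "(real N - 2 * of_int (int L)) * \<Delta> \<le> real M * \<Delta>"
    using c \<Delta>_pos by (intro mult_right_mono) auto
  then have le: "(real N - 2 * of_int (int L)) * \<Delta> \<le> A"
    using c(6)[folded \<Delta>] by linarith
  have "(real M + 1) * \<Delta> \<le> (real N + 2 - 2 * of_int (int L)) * \<Delta>"
    using c \<Delta>_pos by (intro mult_right_mono) auto
  then have ge: "A \<le> (real N + 2 - 2 * of_int (int L)) * \<Delta>"
    using c(7)[folded \<Delta>] by linarith
  have "var N x \<le> var N (ramp A \<Delta> (- of_int (int L) * \<Delta>))"
  proof (intro var_le_centred_ramp)
    show "0 \<le> x n \<and> x n \<le> A" if "n \<in> {1..N}" for n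
      using assms that unfolding feasible_def by blast
    show "\<bar>x (Suc n) - x n\<bar> \<le> \<Delta>" if "1 \<le> n" "n < N" for n
      using feasible_gap[OF assms pos(3) that] \<Delta> by simp
  qed (use le ge pos N_ge_2 \<Delta>_pos in auto)
  then show ?thesis
    using x_SC_eq_ramp[of vm Ts N A L R M] c \<Delta>_pos \<Delta> pos by (simp cong: var_cong)
qed

text \<open>The pair of end points alone yields this. It suffices for positivity and for the order
  in \<open>A\<close>, but is too weak for the order in \<open>N\<close>.\<close>

lemma var_SC_ge: "A\<^sup>2 \<le> (real N)\<^sup>2 * var N (x_SC vm Ts N A)"
  using var_ge_sq_diff[of N N 1 "x_SC vm Ts N A"] N_ge_2 x_SC_ends by simp

lemma var_SC_pos: "0 < var N (x_SC vm Ts N A)"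
proof -
  have "0 < (real N)\<^sup>2 * var N (x_SC vm Ts N A)"
    using var_SC_ge pos by (smt (verit) zero_less_power)
  then show ?thesis by (simp add: zero_less_mult_iff)
qed

lemma SC_sums:
  fixes M R :: real
  defines "M \<equiv> of_int (N_M \<Delta> A)" and "R \<equiv> of_int \<lfloor>(real N - of_int (N_M \<Delta> A)) / 2\<rfloor>"
  shows "(\<Sum>n = 1..N. x_SC vm Ts N A n) = \<Delta> / 2 * M * (M + 1) + R * A"
    and "(\<Sum>n = 1..N. (x_SC vm Ts N A n)\<^sup>2) = \<Delta>\<^sup>2 / 6 * M * (M + 1) * (2 * M + 1) + A\<^sup>2 * R"
proof -
  obtain l m r :: nat where c: "N_L \<Delta> N A = int l" "N_M \<Delta> A = int m" "N_R \<Delta> N A = int r"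
    "N = l + m + r"
    using SC_counts[OF pos(1) \<Delta>_pos constrained] by metis
  have M: "M = real m" using c by (simp add: M_def)
  have R: "R = real r" using c unfolding R_def N_R_def by simp
  \<comment> \<open>One decomposition into three blocks serves both sums, with \<open>f\<close> the
    identity and the square; \<open>f 0 = 0\<close> removes the block at 0.\<close>
  have split: "(\<Sum>n = 1..N. f (x_SC vm Ts N A n)) = (\<Sum>k = 1..m. f (real k * \<Delta>)) + real r * f A"
    if "f 0 = 0" for f :: "real \<Rightarrow> real"
  proof -
    let ?x = "x_SC vm Ts N A"
    note x = x_SC_cases[of vm Ts N A l r m, folded \<Delta>, OF c(1,3,4)]
    have "{1..N} = {1..l} \<union> {l + 1..l + m} \<union> {l + m + 1..l + m + r}"
      using c by auto
    then have "(\<Sum>n = 1..N. f (?x n))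
        = (\<Sum>n = 1..l. f (?x n)) + (\<Sum>n = l + 1..l + m. f (?x n)) + (\<Sum>n = l + m + 1..l + m + r. f (?x n))"
      by (simp only:) (subst sum.union_disjoint; auto simp: sum.union_disjoint)+
    moreover have "(\<Sum>n = 1..l. f (?x n)) = 0"
      using that by (simp add: x)
    moreover have "(\<Sum>n = l + 1..l + m. f (?x n)) = (\<Sum>k = 1..m. f (real k * \<Delta>))"
      by (rule sum.reindex_bij_witness[of _ "\<lambda>k. k + l" "\<lambda>n. n - l"]) (auto simp: x)
    moreover have "(\<Sum>n = l + m + 1..l + m + r. f (?x n)) = real r * f A"
      by (simp add: x)
    ultimately show ?thesis by simp
  qed
  have s1: "(\<Sum>k = 1..m. real k) = real m * (real m + 1) / 2"
    by (induction m) (simp_all add: field_simps)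
  have s2: "(\<Sum>k = 1..m. (real k)\<^sup>2) = real m * (real m + 1) * (2 * real m + 1) / 6"
    by (induction m) (simp_all add: field_simps power2_eq_square)
  show "(\<Sum>n = 1..N. x_SC vm Ts N A n) = \<Delta> / 2 * M * (M + 1) + R * A"
    using split[of "\<lambda>t. t"] s1 by (simp add: M R flip: sum_distrib_right)
  show "(\<Sum>n = 1..N. (x_SC vm Ts N A n)\<^sup>2) = \<Delta>\<^sup>2 / 6 * M * (M + 1) * (2 * M + 1) + A\<^sup>2 * R"
    using split[of power2] s2 by (simp add: M R power_mult_distrib flip: sum_distrib_right)
qed

text \<open>The hypothesis makes both wall groups hold at least \<open>N / 4\<close> samples. The
  pairs between them contribute at least \<open>(N / 4)\<^sup>2 A\<^sup>2\<close>, and the factor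
  1/2 of \<open>var_pairs\<close> turns 16 into 32.\<close>

lemma var_SC_lower:
  assumes "2 * (real_of_int (N_M \<Delta> A) + 1) \<le> real N"
  shows "real N * A\<^sup>2 / 32 \<le> real N * var N (x_SC vm Ts N A)"
proof -
  obtain L M R :: nat where c: "N_L (vm * Ts) N A = int L" "N_M (vm * Ts) A = int M"
    "N_R (vm * Ts) N A = int R" "N = L + M + R" "R \<le> L" "L \<le> R + 1"
    using SC_counts[OF pos(1) \<Delta>_pos constrained] \<Delta> by metis
  let ?x = "x_SC vm Ts N A"
  have R: "real N \<le> 4 * real R"
    using assms c by (simp add: \<Delta>)
  have "(\<Sum>i\<in>{L + M + 1..N}. \<Sum>j\<in>{1..L}. (?x i - ?x j)\<^sup>2) = real R * (real L * A\<^sup>2)"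
  proof -
    have "(\<Sum>i\<in>{L + M + 1..N}. \<Sum>j\<in>{1..L}. (?x i - ?x j)\<^sup>2)
        = (\<Sum>i\<in>{L + M + 1..N}. \<Sum>j\<in>{1..L}. A\<^sup>2)"
      by (intro sum.cong refl) (auto simp: x_SC_cases[OF c(1,3,4)])
    then show ?thesis using c(4) by simp
  qed
  moreover have "(\<Sum>i\<in>{L + M + 1..N}. \<Sum>j\<in>{1..L}. (?x i - ?x j)\<^sup>2)
      \<le> (\<Sum>i = 1..N. \<Sum>j = 1..N. (?x i - ?x j)\<^sup>2)"
  proof -
    have "(\<Sum>i\<in>{L + M + 1..N}. \<Sum>j\<in>{1..L}. (?x i - ?x j)\<^sup>2)
        \<le> (\<Sum>i\<in>{L + M + 1..N}. \<Sum>j = 1..N. (?x i - ?x j)\<^sup>2)"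
      using c(4) by (intro sum_mono sum_mono2) auto
    also have "\<dots> \<le> (\<Sum>i = 1..N. \<Sum>j = 1..N. (?x i - ?x j)\<^sup>2)"
      by (intro sum_mono2) (auto simp: sum_nonneg)
    finally show ?thesis .
  qed
  moreover have "(real N / 4) * (real N / 4 * A\<^sup>2) \<le> real R * (real L * A\<^sup>2)"
    using R c(5) by (intro mult_mono) auto
  moreover have "(real N / 4) * (real N / 4 * A\<^sup>2) / 2 = real N * (real N * A\<^sup>2 / 32)"
    by simp
  moreover have "(real N)\<^sup>2 * var N ?x = (\<Sum>i = 1..N. \<Sum>j = 1..N. (?x i - ?x j)\<^sup>2) / 2"
    using N_ge_2 by (intro var_pairs) simp
  ultimately have "real N * (real N * A\<^sup>2 / 32) \<le> (real N)\<^sup>2 * var N ?x"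
    by linarith
  then have "real N * (real N * A\<^sup>2 / 32) \<le> real N * (real N * var N ?x)"
    by (simp only: power2_eq_square mult.assoc)
  then show ?thesis
    using N_ge_2 by (subst (asm) mult_le_cancel_left_pos) auto
qed

end

section \<open>Strict growth of the optimal variance with \<open>N\<close> and with
  \<open>A\<close>\<close>

lemma SC_var_strict_mono_length:
  assumes "0 < A" "0 < vm" "0 < Ts" "A < (real N - 1) * (vm * Ts)"
  shows "real N * var N (x_SC vm Ts N A) < real (Suc N) * var (Suc N) (x_SC vm Ts (Suc N) A)"
proof -
  note SC = assms(1-3) refl assms(4)
  let ?x = "x_SC vm Ts N A"
  have "0 < vm * Ts" using assms by simp
  then have A': "A < (real (Suc N) - 1) * (vm * Ts)"
    using assms(4) by (simp add: algebra_simps)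
  have N: "2 \<le> N" by (rule N_ge_2[OF SC])
  \<comment> \<open>The path for \<open>N\<close> is kept and one sample is added at
    \<open>A\<close>. The gain in \<open>N\<close> times the variance is a square over
    \<open>N (N + 1)\<close>, positive because the first sample is 0 and so the mean lies below
    \<open>A\<close>.\<close>
  define S where "S = (\<Sum>n = 1..N. ?x n)"
  define S2 where "S2 = (\<Sum>n = 1..N. (?x n)\<^sup>2)"
  have last: "?x (Suc N) = A"
    using x_SC_bounds(2)[OF SC, of "Suc N"] x_SC_mono[OF SC, of N "Suc N"] x_SC_ends(2)[OF SC]
    by simp
  have "S < (\<Sum>n = 1..N. A)"
    unfolding S_def
    using N x_SC_bounds(2)[OF SC] x_SC_ends(1)[OF SC] assms(1)
    by (intro sum_strict_mono_ex1) (auto intro!: bexI[of _ 1])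
  then have "S < real N * A" by simp
  have scaled: "real n * var n x = (\<Sum>k = 1..n. (x k)\<^sup>2) - (\<Sum>k = 1..n. x k)\<^sup>2 / real n" if "0 < n" for n x
    using var_scaled[OF that, of x] that by (simp add: power2_eq_square field_simps)
  have "real N * var N ?x = S2 - S\<^sup>2 / real N"
    using N unfolding S_def S2_def by (intro scaled) simp
  moreover have "real (Suc N) * var (Suc N) ?x = S2 + A\<^sup>2 - (S + A)\<^sup>2 / (real N + 1)"
    using scaled[of "Suc N" ?x] by (simp add: last S_def S2_def add.commute)
  ultimately have "real (Suc N) * var (Suc N) ?x - real N * var N ?x
      = A\<^sup>2 - (S + A)\<^sup>2 / (real N + 1) + S\<^sup>2 / real N"
    by simp
  also have "\<dots> = (real N * A - S)\<^sup>2 / (real N * (real N + 1))"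
    using N by (simp add: power2_eq_square divide_simps) (simp add: algebra_simps)
  also have "\<dots> > 0"
    using \<open>S < real N * A\<close> N by (intro divide_pos_pos) auto
  finally have "real N * var N ?x < real (Suc N) * var (Suc N) ?x" by simp
  also have "feasible A vm Ts (Suc N) (?x, \<lambda>n. (?x (Suc n) - ?x n) / Ts)"
    using x_SC_bounds[OF SC] x_SC_gap[OF SC] assms by (intro feasibleI) auto
  then have "real (Suc N) * var (Suc N) ?x \<le> real (Suc N) * var (Suc N) (x_SC vm Ts (Suc N) A)"
    by (intro mult_left_mono var_le_var_SC[OF assms(1-3) refl A']) auto
  finally show ?thesis .
qed

text \<open>
  When \<open>A\<close> grows, some step of the old path is shorter than \<open>\<Delta>\<close>; lengthening it moves all
  later points away from all earlier ones.
\<close>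

lemma SC_var_strict_mono_space:
  assumes "0 < A" "A < A'" "0 < vm" "0 < Ts" "A' < (real N - 1) * (vm * Ts)"
  shows "var N (x_SC vm Ts N A) < var N (x_SC vm Ts N A')"
proof -
  have A: "A < (real N - 1) * (vm * Ts)" and "0 < A'" using assms by auto
  note SC = assms(1) assms(3,4) refl A
  let ?x = "x_SC vm Ts N A" and ?\<Delta> = "vm * Ts"
  have N: "2 \<le> N" by (rule N_ge_2[OF SC])
  \<comment> \<open>Otherwise the path would cover \<open>(N - 1) \<Delta>\<close>, which exceeds
    \<open>A\<close>.\<close>
  have "\<exists>k. 1 \<le> k \<and> k < N \<and> ?x (Suc k) - ?x k < ?\<Delta>"
  proof (rule ccontr)
    assume "\<not> ?thesis"
    then have full: "?\<Delta> \<le> ?x (Suc k) - ?x k" if "1 \<le> k" "k < N" for k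
      using that by (meson not_less)
    have "(real n - 1) * ?\<Delta> \<le> ?x n" if "1 \<le> n" "n \<le> N" for n
      using that
    proof (induction n rule: dec_induct)
      case base
      then show ?case using x_SC_ends(1)[OF SC] by simp
    next
      case (step m)
      then show ?case using full[of m] by (simp add: algebra_simps)
    qed
    from this[of N] show False
      using N x_SC_ends(2)[OF SC] A by simp
  qed
  then obtain k where k: "1 \<le> k" "k < N" "?x (Suc k) - ?x k < ?\<Delta>" by blast
  \<comment> \<open>The lengthening is limited by the slack of step \<open>k\<close> and by the
    additional room.\<close>
  define \<epsilon> where "\<epsilon> = min (?\<Delta> - (?x (Suc k) - ?x k)) (A' - A)"
  have \<epsilon>: "0 < \<epsilon>" "?x (Suc k) - ?x k + \<epsilon> \<le> ?\<Delta>" "\<epsilon> \<le> A' - A"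
    using k assms by (auto simp: \<epsilon>_def)
  define y where "y n = ?x n + (if k < n then \<epsilon> else 0)" for n
  have "var N ?x < var N y"
  proof (rule var_strict_mono_differences[OF N])
    show "0 \<le> ?x j - ?x i \<and> ?x j - ?x i \<le> y j - y i" if "1 \<le> i" "i \<le> j" "j \<le> N" for i j
      using x_SC_mono[OF SC \<open>i \<le> j\<close>] \<epsilon> that by (auto simp: y_def)
    show "?x N - ?x 1 < y N - y 1"
      using k \<epsilon> by (simp add: y_def)
  qed
  also have "feasible A' vm Ts N (y, \<lambda>n. (y (Suc n) - y n) / Ts)"
  proof (rule feasibleI)
    show "0 \<le> y n \<and> y n \<le> A'" if "n \<in> {1..N}" for n
      using x_SC_bounds[OF SC, of n] \<epsilon> assms by (auto simp: y_def)
    show "\<bar>y (Suc n) - y n\<bar> \<le> ?\<Delta>" if "1 \<le> n" "n < N" for n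
    proof (cases "n = k")
      case True
      then show ?thesis
        using x_SC_mono[OF SC, of n "Suc n"] \<epsilon> by (simp add: y_def)
    next
      case False
      then show ?thesis
        using x_SC_gap[OF SC, of n] by (auto simp: y_def)
    qed
  qed (use assms in auto)
  then have "var N y \<le> var N (x_SC vm Ts N A')"
    by (rule var_le_var_SC[OF \<open>0 < A'\<close> assms(3,4) refl assms(5)])
  finally show ?thesis .
qed

subsection \<open>The minimum bound\<close>

context
  fixes \<sigma> lam P :: real and \<beta> :: complex
  assumes pos: "0 < \<sigma>\<^sup>2" "0 < lam" "0 < P" "0 < cmod \<beta>"
begin

lemma CRB_constant_pos: "0 < \<sigma>\<^sup>2 * lam\<^sup>2 / (8 * pi\<^sup>2 * P * (cmod \<beta>)\<^sup>2)"
  using pos by (intro divide_pos_pos mult_pos_pos) auto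

text \<open>Where it is finite, the bound depends on \<open>N\<close> and \<open>x\<close> only
  through \<open>real N * var N x\<close>; comparisons across different \<open>N\<close> therefore
  concern this product.\<close>

lemma CRB_eq:
  assumes "var N x \<noteq> 0"
  shows "CRB \<sigma> lam P \<beta> N x =
    ereal (\<sigma>\<^sup>2 * lam\<^sup>2 / (8 * pi\<^sup>2 * P * (cmod \<beta>)\<^sup>2) * (1 / (real N * var N x)))"
  using assms by (simp add: CRB_def ac_simps)

lemma CRB_strict_antimono:
  assumes "0 < real N * var N x" "real N * var N x < real N' * var N' y"
  shows "CRB \<sigma> lam P \<beta> N' y < CRB \<sigma> lam P \<beta> N x"
proof -
  have nz: "var N x \<noteq> 0" "var N' y \<noteq> 0" using assms by auto
  have "1 / (real N' * var N' y) < 1 / (real N * var N x)"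
    by (rule frac_less2) (use assms in auto)
  then show ?thesis
    unfolding nz[THEN CRB_eq] less_ereal.simps by (intro mult_strict_left_mono CRB_constant_pos)
qed

lemma CRB_antimono:
  assumes "0 < N" "0 < var N y" "var N x \<le> var N y"
  shows "CRB \<sigma> lam P \<beta> N y \<le> CRB \<sigma> lam P \<beta> N x"
proof (cases "var N x = 0")
  case True
  then show ?thesis by (simp add: CRB_def)
next
  case False
  then have "0 < var N x" using var_nonneg[OF assms(1), of x] by simp
  then have "var N x = var N y \<or> CRB \<sigma> lam P \<beta> N y < CRB \<sigma> lam P \<beta> N x"
    using assms by (cases "var N x = var N y") (auto intro: CRB_strict_antimono)
  then show ?thesis
    by (auto simp: CRB_def)
qed

lemma min_CRB_eq:
  assumes "0 < A" "0 < vm" "0 < Ts" "A < (real N - 1) * (vm * Ts)"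
  shows "min_CRB \<sigma> lam P \<beta> vm Ts N A = CRB \<sigma> lam P \<beta> N (x_SC vm Ts N A)"
proof -
  note SC = assms(1-3) refl assms(4)
  have "CRB \<sigma> lam P \<beta> N (x_SC vm Ts N A) \<le> CRB \<sigma> lam P \<beta> N x" if "feasible A vm Ts N (x, v)" for x v
    using N_ge_2[OF SC] var_SC_pos[OF SC] var_le_var_SC[OF SC that] by (intro CRB_antimono) auto
  then show ?thesis
    unfolding min_CRB_def using feasible_SC[OF SC]
    by (intro antisym INF_greatest INF_lower2[of "(x_SC vm Ts N A, v_SC vm Ts N A)"]) auto
qed

lemma CRB_SC_eq:
  assumes "0 < A" "0 < vm" "0 < Ts" "A < (real N - 1) * (vm * Ts)"
  shows "CRB \<sigma> lam P \<beta> N (x_SC vm Ts N A) =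
    ereal (\<sigma>\<^sup>2 * lam\<^sup>2 / (8 * pi\<^sup>2 * P * (cmod \<beta>)\<^sup>2) * (1 / (real N * var N (x_SC vm Ts N A))))"
  using var_SC_pos[OF assms(1-3) refl assms(4)] by (intro CRB_eq) simp

section \<open>Monotonicity and order of the minimum bound\<close>

lemma min_CRB_strict_antimono_length:
  assumes "0 < A" "0 < vm" "0 < Ts" "A < (real N - 1) * (vm * Ts)" "N < N'"
  shows "min_CRB \<sigma> lam P \<beta> vm Ts N' A < min_CRB \<sigma> lam P \<beta> vm Ts N A"
proof -
  have "0 < vm * Ts" using assms by simp
  then have larger: "A < (real m - 1) * (vm * Ts)" if "N \<le> m" for m
    using assms(4) that mult_right_mono[of "real N - 1" "real m - 1" "vm * Ts"] by simp
  have decrease: "min_CRB \<sigma> lam P \<beta> vm Ts (Suc m) A < min_CRB \<sigma> lam P \<beta> vm Ts m A" if "N \<le> m" for m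
  proof -
    note SC = assms(1-3) larger[OF that]
    have "0 < real m * var m (x_SC vm Ts m A)"
      using N_ge_2[OF assms(1-3) refl larger[OF that]] var_SC_pos[OF assms(1-3) refl larger[OF that]]
      by simp
    then show ?thesis
      using SC_var_strict_mono_length[OF SC] min_CRB_eq[OF SC] min_CRB_eq[OF assms(1-3) larger[of "Suc m"]] that
      by (simp add: CRB_strict_antimono)
  qed
  from Suc_leI[OF \<open>N < N'\<close>] show ?thesis
  proof (induction N' rule: dec_induct)
    case base
    show ?case by (rule decrease) simp
  next
    case (step m)
    then show ?case using decrease[of m] by simp
  qed
qed

lemma min_CRB_strict_antimono_space:
  assumes "0 < A" "A < A'" "0 < vm" "0 < Ts" "A' < (real N - 1) * (vm * Ts)"
  shows "min_CRB \<sigma> lam P \<beta> vm Ts N A' < min_CRB \<sigma> lam P \<beta> vm Ts N A"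
proof -
  have A: "A < (real N - 1) * (vm * Ts)" "0 < A'" using assms by auto
  note N = N_ge_2[OF assms(1,3,4) refl A(1)]
  have "real N * var N (x_SC vm Ts N A) < real N * var N (x_SC vm Ts N A')"
    using SC_var_strict_mono_space[OF assms] N by simp
  moreover have "0 < real N * var N (x_SC vm Ts N A)"
    using var_SC_pos[OF assms(1,3,4) refl A(1)] N by simp
  ultimately show ?thesis
    using min_CRB_eq[OF assms(1,3,4) A(1)] min_CRB_eq[OF A(2) assms(3,4,5)]
    by (simp add: CRB_strict_antimono)
qed

lemma min_CRB_bigo:
  assumes "0 < A" "0 < vm" "0 < Ts"
  shows "(\<lambda>N. real_of_ereal (min_CRB \<sigma> lam P \<beta> vm Ts N A)) \<in> O(\<lambda>N. 1 / real N)"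
proof -
  let ?\<Delta> = "vm * Ts"
  define K where "K = \<sigma>\<^sup>2 * lam\<^sup>2 / (8 * pi\<^sup>2 * P * (cmod \<beta>)\<^sup>2)"
  have "0 < ?\<Delta>" using assms by simp
  have "norm (real_of_ereal (min_CRB \<sigma> lam P \<beta> vm Ts N A)) \<le> (32 * K / A\<^sup>2) * norm (1 / real N)"
    \<comment> \<open>Since \<open>N_M + 1\<close> is the ceiling of \<open>A / \<Delta>\<close>,
      this threshold ensures both the space-constrained regime and the hypothesis of
      \<open>var_SC_lower\<close>, whose constant 32 reappears here.\<close>
    if N: "2 * nat \<lceil>A / ?\<Delta>\<rceil> + 2 \<le> N" for N
  proof -
    have "0 < A / ?\<Delta>" using assms by simp
    then have "0 < \<lceil>A / ?\<Delta>\<rceil>" by simp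
    then have rN: "2 * of_int \<lceil>A / ?\<Delta>\<rceil> + 2 \<le> real N"
      using N by linarith
    then have "A / ?\<Delta> < real N - 1"
      using \<open>0 < A / ?\<Delta>\<close> le_of_int_ceiling[of "A / ?\<Delta>"] by linarith
    then have A: "A < (real N - 1) * ?\<Delta>"
      using \<open>0 < ?\<Delta>\<close> by (simp add: pos_divide_less_eq)
    note SC = assms refl A
    have lower: "real N * A\<^sup>2 / 32 \<le> real N * var N (x_SC vm Ts N A)"
      using rN by (intro var_SC_lower[OF SC]) (simp add: N_M_def)
    have "0 < real N * A\<^sup>2 / 32"
      using N assms by simp
    then have "0 < real N * var N (x_SC vm Ts N A)" using lower by linarith
    then have "1 / (real N * var N (x_SC vm Ts N A)) \<le> 1 / (real N * A\<^sup>2 / 32)"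
      using lower \<open>0 < real N * A\<^sup>2 / 32\<close> by (intro frac_le) simp_all
    then have "K * (1 / (real N * var N (x_SC vm Ts N A))) \<le> K * (1 / (real N * A\<^sup>2 / 32))"
      using CRB_constant_pos by (intro mult_left_mono) (auto simp: K_def)
    moreover have "real_of_ereal (min_CRB \<sigma> lam P \<beta> vm Ts N A) = K * (1 / (real N * var N (x_SC vm Ts N A)))"
      unfolding min_CRB_eq[OF assms A] CRB_SC_eq[OF assms A] K_def by simp
    moreover have "0 \<le> K * (1 / (real N * var N (x_SC vm Ts N A)))"
      using CRB_constant_pos \<open>0 < real N * var N (x_SC vm Ts N A)\<close> unfolding K_def
      by (intro mult_nonneg_nonneg) auto
    ultimately show ?thesis
      by (simp add: ac_simps)
  qed
  then show ?thesis
    by (intro bigoI eventually_sequentiallyI)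
qed

lemma min_CRB_le_inverse_square:
  assumes "0 < A" "0 < vm" "0 < Ts" "A < (real N - 1) * (vm * Ts)"
  shows "min_CRB \<sigma> lam P \<beta> vm Ts N A
    \<le> ereal (\<sigma>\<^sup>2 * lam\<^sup>2 / (8 * pi\<^sup>2 * P * (cmod \<beta>)\<^sup>2) * real N / A\<^sup>2)"
proof -
  note SC = assms(1-3) refl assms(4)
  let ?V = "real N * var N (x_SC vm Ts N A)"
  have N: "0 < real N" using N_ge_2[OF SC] by simp
  have "A\<^sup>2 / real N \<le> ?V"
    using var_SC_ge[OF SC] N by (simp add: pos_divide_le_eq power2_eq_square ac_simps)
  moreover have "0 < A\<^sup>2 / real N" using N assms by simp
  ultimately have "1 / ?V \<le> 1 / (A\<^sup>2 / real N)"
    by (intro frac_le) simp_all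
  then have "\<sigma>\<^sup>2 * lam\<^sup>2 / (8 * pi\<^sup>2 * P * (cmod \<beta>)\<^sup>2) * (1 / ?V)
      \<le> \<sigma>\<^sup>2 * lam\<^sup>2 / (8 * pi\<^sup>2 * P * (cmod \<beta>)\<^sup>2) * (1 / (A\<^sup>2 / real N))"
    using CRB_constant_pos by (intro mult_left_mono) auto
  then show ?thesis
    unfolding min_CRB_eq[OF assms] CRB_SC_eq[OF assms] by simp
qed

end

theorem theorem2:
  fixes N :: nat and A Ts vm lam \<sigma> P \<Delta> :: real and \<beta> :: complex
  assumes "N \<ge> 2"
    and "A > 0" and "Ts > 0" and "vm > 0" and "lam > 0" and "\<sigma>\<^sup>2 > 0" and "P > 0"
    and "cmod \<beta> > 0"
    and "\<Delta> = vm * Ts"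
    and "A < (real N - 1) * \<Delta>"
  shows
    "is_arg_min (\<lambda>(x, v). CRB \<sigma> lam P \<beta> N x) (feasible A vm Ts N)
        (x_SC vm Ts N A, v_SC vm Ts N A)
     \<and> min_CRB \<sigma> lam P \<beta> vm Ts N A = CRB \<sigma> lam P \<beta> N (x_SC vm Ts N A)
     \<and> CRB \<sigma> lam P \<beta> N (x_SC vm Ts N A) =
         ereal (\<sigma>\<^sup>2 * lam\<^sup>2 / (8 * pi\<^sup>2 * P * (cmod \<beta>)\<^sup>2)
                * (1 / (real N * var N (x_SC vm Ts N A))))
     \<and> var N (x_SC vm Ts N A) =
         (let M = real_of_int (N_M \<Delta> A);
              R = real_of_int \<lfloor>(real N - M) / 2\<rfloor>
          in \<Delta>\<^sup>2 / (6 * real N) * M * (M + 1) * (2 * M + 1)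
             + A\<^sup>2 / real N * R
             - 1 / (real N)\<^sup>2 * (\<Delta> / 2 * M * (M + 1) + R * A)\<^sup>2)
     \<and> monotone_on {N'. N' \<ge> 2 \<and> A < (real N' - 1) * \<Delta>} (<) (>)
         (\<lambda>N'. min_CRB \<sigma> lam P \<beta> vm Ts N' A)
     \<and> (\<lambda>N'. real_of_ereal (min_CRB \<sigma> lam P \<beta> vm Ts N' A)) \<in> O(\<lambda>N'. 1 / real N')
     \<and> monotone_on {0<..<(real N - 1) * \<Delta>} (<) (>)
         (\<lambda>A'. min_CRB \<sigma> lam P \<beta> vm Ts N A')
     \<and> (\<exists>C. \<forall>A'\<in>{0<..<(real N - 1) * \<Delta>}.
           min_CRB \<sigma> lam P \<beta> vm Ts N A' \<le> ereal (C / A'\<^sup>2))"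
proof (intro conjI)
  have A: "A < (real N - 1) * (vm * Ts)" using assms by simp
  note params = assms(6,5,7,8)
  note SC = assms(2,4,3) refl A
  show min: "min_CRB \<sigma> lam P \<beta> vm Ts N A = CRB \<sigma> lam P \<beta> N (x_SC vm Ts N A)"
    by (rule min_CRB_eq[OF params assms(2,4,3) A])
  have "CRB \<sigma> lam P \<beta> N (x_SC vm Ts N A) \<le> CRB \<sigma> lam P \<beta> N x"
    if "feasible A vm Ts N (x, v)" for x v
    unfolding min[symmetric] min_CRB_def using that by (intro INF_lower2[of "(x, v)"]) auto
  then show "is_arg_min (\<lambda>(x, v). CRB \<sigma> lam P \<beta> N x) (feasible A vm Ts N)
      (x_SC vm Ts N A, v_SC vm Ts N A)"
    using feasible_SC[OF SC] by (auto simp: is_arg_min_def not_less)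
  show "CRB \<sigma> lam P \<beta> N (x_SC vm Ts N A) =
      ereal (\<sigma>\<^sup>2 * lam\<^sup>2 / (8 * pi\<^sup>2 * P * (cmod \<beta>)\<^sup>2) * (1 / (real N * var N (x_SC vm Ts N A))))"
    by (rule CRB_SC_eq[OF params assms(2,4,3) A])
  show "var N (x_SC vm Ts N A) =
      (let M = real_of_int (N_M \<Delta> A);
           R = real_of_int \<lfloor>(real N - M) / 2\<rfloor>
       in \<Delta>\<^sup>2 / (6 * real N) * M * (M + 1) * (2 * M + 1)
          + A\<^sup>2 / real N * R
          - 1 / (real N)\<^sup>2 * (\<Delta> / 2 * M * (M + 1) + R * A)\<^sup>2)"
    unfolding var_def mu_def SC_sums[OF assms(2,4,3,9,10)] Let_def power_mult_distrib power_divide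
    by (simp add: add_divide_distrib)
  show "monotone_on {N'. N' \<ge> 2 \<and> A < (real N' - 1) * \<Delta>} (<) (>)
      (\<lambda>N'. min_CRB \<sigma> lam P \<beta> vm Ts N' A)"
    using min_CRB_strict_antimono_length[OF params assms(2,4,3)] assms(9)
    by (auto intro!: monotone_onI)
  show "(\<lambda>N'. real_of_ereal (min_CRB \<sigma> lam P \<beta> vm Ts N' A)) \<in> O(\<lambda>N'. 1 / real N')"
    by (rule min_CRB_bigo[OF params assms(2,4,3)])
  show "monotone_on {0<..<(real N - 1) * \<Delta>} (<) (>) (\<lambda>A'. min_CRB \<sigma> lam P \<beta> vm Ts N A')"
    using min_CRB_strict_antimono_space[OF params _ _ assms(4,3)] assms(9)
    by (auto intro!: monotone_onI)
  show "\<exists>C. \<forall>A'\<in>{0<..<(real N - 1) * \<Delta>}. min_CRB \<sigma> lam P \<beta> vm Ts N A' \<le> ereal (C / A'\<^sup>2)"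
    unfolding assms(9)
    \<comment> \<open>The witness stays schematic until \<open>min_CRB_le_inverse_square\<close>
      fixes it; the constant found there contains \<open>N\<close> but not
      \<open>A'\<close>.\<close>
    by (rule exI, rule ballI, rule min_CRB_le_inverse_square[OF params _ assms(4,3)]) auto
qed

end
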